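(* Let $0\le b\le c\le d$ be integers such that $\Gamma(0,b,c,d)$ is a simple graph, and suppose $d<b+c+3$. Then $\Gamma(0,b,c,d)$ has avoidance index $2$ if and only if it is bipartite.
   Context: For integers $0\le a\le b\le c\le d$, $\Gamma(a,b,c,d)$ is the graph consisting of two vertices $u,v$ (each of valency 4) joined by four internally vertex-disjoint paths A, B, C, D having respectively $a,b,c,d$ internal vertices (all of valency 2); with $a=0$, $u$ and $v$ are adjacent. Graphs are simple. An Eulerian circuit is a closed trail traversing every edge exactly once. For an Eulerian graph with $m$ edges and vertex $x$, two Eulerian circuits $x,v_1,\ldots,v_{m-1},x$ and $x,w_1,\ldots,w_{m-1},x$ are avoiding if for each $1\le i\le m-1$, $v_i\ne w_i$ and $v_i,w_i$ are non-adjacent; a set of Eulerian circuits is mutually avoiding if they are pairwise avoiding. The avoidance index $\mathrm{av}(G)$ of an Eulerian graph $G$ is the largest $k$ such that for every vertex $x$ there is a set of $k$ mutually avoiding Eulerian circuits starting and ending at $x$. *)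

theory Defs
  imports Main "HOL-Library.Multiset"
begin

text \<open>
  Undirected multigraphs. An edge is the set of its end vertices, so a loop is a singleton, and
  parallel edges are repeated elements of the multiset of edges. Multigraphs are needed only so
  that simplicity is a property that a member of the family defined below may or may not have:
  if two of its paths have no internal vertices, the edge joining their common ends is doubled.
\<close>

record 'v multigraph =
  verts :: "'v set"
  edges :: "'v set multiset"

definition simple_graph :: "'v multigraph \<Rightarrow> bool" where
  "simple_graph G \<longleftrightarrow>
     (\<forall>e \<in># edges G. e \<subseteq> verts G \<and> card e = 2 \<and> count (edges G) e = 1)"

definition adjacent :: "'v multigraph \<Rightarrow> 'v \<Rightarrow> 'v \<Rightarrow> bool" where
  "adjacent G x y \<longleftrightarrow> {x, y} \<in># edges G"

definition bipartite :: "'v multigraph \<Rightarrow> bool" where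
  "bipartite G \<longleftrightarrow>
     (\<exists>X Y. X \<union> Y = verts G \<and> X \<inter> Y = {} \<and>
            (\<forall>e \<in># edges G. \<exists>x \<in> X. \<exists>y \<in> Y. e = {x, y}))"

definition walk_edges :: "'v list \<Rightarrow> 'v set list" where
  "walk_edges p = map (\<lambda>(x, y). {x, y}) (zip p (tl p))"

text \<open>
  A circuit is given by its sequence of vertices, the base vertex occurring at both ends. Equality
  of multisets says that every step is along an edge and that each edge is traversed exactly once.
\<close>

definition eulerian_circuit :: "'v multigraph \<Rightarrow> 'v \<Rightarrow> 'v list \<Rightarrow> bool" where
  "eulerian_circuit G x p \<longleftrightarrow>
     p \<noteq> [] \<and> hd p = x \<and> last p = x \<and> set p \<subseteq> verts G \<and>
     mset (walk_edges p) = edges G"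

definition avoiding :: "'v multigraph \<Rightarrow> 'v list \<Rightarrow> 'v list \<Rightarrow> bool" where
  "avoiding G p q \<longleftrightarrow>
     (\<forall>i. 1 \<le> i \<and> i \<le> size (edges G) - 1 \<longrightarrow> p ! i \<noteq> q ! i \<and> \<not> adjacent G (p ! i) (q ! i))"

definition mutually_avoiding :: "'v multigraph \<Rightarrow> 'v list set \<Rightarrow> bool" where
  "mutually_avoiding G S \<longleftrightarrow> pairwise (avoiding G) S"

text \<open>
  In a simple Eulerian graph with a vertex of positive degree the maximum exists: the circuits of a
  mutually avoiding set based at \<open>x\<close> have distinct second vertices, all of them neighbours of \<open>x\<close>.
\<close>

definition avoidance_index :: "'v multigraph \<Rightarrow> nat" where
  "avoidance_index G =
     (GREATEST k. \<forall>x \<in> verts G. \<exists>S. finite S \<and> card S = k \<and>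
        (\<forall>p \<in> S. eulerian_circuit G x p) \<and> mutually_avoiding G S)"

datatype path_name = PathA | PathB | PathC | PathD

datatype gamma_vertex = U | V | Inner path_name nat

definition gamma_path :: "path_name \<Rightarrow> nat \<Rightarrow> gamma_vertex list" where
  "gamma_path P n = U # map (Inner P) [0..<n] @ [V]"

definition Gamma :: "nat \<Rightarrow> nat \<Rightarrow> nat \<Rightarrow> nat \<Rightarrow> gamma_vertex multigraph" where
  "Gamma a b c d =
     \<lparr> verts = set (gamma_path PathA a) \<union> set (gamma_path PathB b) \<union>
               set (gamma_path PathC c) \<union> set (gamma_path PathD d),
       edges = mset (walk_edges (gamma_path PathA a)) + mset (walk_edges (gamma_path PathB b)) +
               mset (walk_edges (gamma_path PathC c)) + mset (walk_edges (gamma_path PathD d)) \<rparr>"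

end

theory Submission
  imports Defs
begin

text \<open>
  A vertex of degree 2 shows that the index is at most 2. If a path has even length, then from its
  midpoint one of two avoiding circuits must start towards \<open>U\<close> and the other towards \<open>V\<close>, and they
  reach these adjacent vertices simultaneously; so index 2 forces all lengths to be odd, which is
  bipartiteness. Conversely, in a bipartite graph two circuits with a common base are always in the
  same colour class, hence never at adjacent vertices, and it suffices to keep them from meeting.
  Let the base lie on the path \<open>P\<close> at distances \<open>s < t\<close> from its ends \<open>E\<close> and \<open>F\<close>. One circuit goes to
  \<open>E\<close>, then along \<open>Q1, Q2, Q3\<close> to \<open>F\<close> and back; the other goes to \<open>F\<close>, then along \<open>Q2, Q3, Q1\<close>
  to \<open>E\<close> and back. Both traverse \<open>Q2\<close> and \<open>Q3\<close> in the same direction but at different times, so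
  only the opposite traversals of \<open>Q1\<close> and the visits to \<open>E\<close> and \<open>F\<close> impose conditions on the lengths.
  These can be met by a suitable choice of \<open>Q1\<close>.
\<close>

section \<open>Edge multisets of walks as sums\<close>

lemma sum_lessThan_add:
  fixes g :: "nat \<Rightarrow> 'a::comm_monoid_add"
  shows "(\<Sum>i<a + l. g i) = (\<Sum>i<a. g i) + (\<Sum>i<l. g (a + i))"
  by (induction l) (simp_all add: add.assoc)

lemma walk_edges_map_upt:
  "walk_edges (map f [0..<Suc m]) = map (\<lambda>i. {f i, f (Suc i)}) [0..<m]"
  by (rule nth_equalityI) (auto simp: walk_edges_def nth_tl simp del: upt_Suc)

lemma mset_map_upt: "mset (map f [0..<m]) = (\<Sum>i<m. {#f i#})"
  by (induction m) simp_all

lemma walk_edges_nth: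
  assumes "Suc i < length p"
  shows "i < length (walk_edges p)" and "walk_edges p ! i = {p ! i, p ! Suc i}"
  using assms by (auto simp: walk_edges_def nth_tl)

lemma length_walk_edges: "length (walk_edges p) = length p - 1"
  by (simp add: walk_edges_def)

section \<open>Eulerian circuits in arbitrary multigraphs\<close>

lemma eulerian_circuit_length:
  assumes "eulerian_circuit G x p"
  shows "length p = Suc (size (edges G))"
proof -
  have "length p - 1 = size (edges G)" "p \<noteq> []"
    using assms length_walk_edges[of p]
    unfolding eulerian_circuit_def by (metis size_mset, simp)
  then show ?thesis by (cases p) auto
qed

lemma eulerian_circuit_nth_0:
  assumes "eulerian_circuit G x p"
  shows "p ! 0 = x"
  using assms by (auto simp: eulerian_circuit_def hd_conv_nth)

lemma eulerian_circuit_step: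
  assumes "eulerian_circuit G x p" and "i < size (edges G)"
  shows "adjacent G (p ! i) (p ! Suc i)"
proof -
  have *: "Suc i < length p" using eulerian_circuit_length[OF assms(1)] assms(2) by simp
  show ?thesis
    using walk_edges_nth[OF *] assms(1)
    unfolding adjacent_def eulerian_circuit_def by (metis nth_mem set_mset_mset)
qed

text \<open>Turning back would traverse the same edge in two consecutive steps, but in a simple
  graph the edges of a circuit are distinct.\<close>

lemma eulerian_circuit_no_backtrack:
  assumes "simple_graph G" and "eulerian_circuit G x p" and i: "Suc i < size (edges G)"
  shows "p ! Suc (Suc i) \<noteq> p ! i"
proof
  assume eq: "p ! Suc (Suc i) = p ! i"
  have len: "Suc i < length p" "Suc (Suc i) < length p"
    using eulerian_circuit_length[OF assms(2)] i by simp_all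
  have "distinct (walk_edges p)"
    using assms(1,2) unfolding simple_graph_def eulerian_circuit_def distinct_count_atmost_1
    by (metis count_eq_zero_iff set_mset_mset)
  moreover have "walk_edges p ! i = walk_edges p ! Suc i"
    using walk_edges_nth(2)[OF len(1)] walk_edges_nth(2)[OF len(2)] eq by auto
  ultimately show False
    using walk_edges_nth(1)[OF len(1)] walk_edges_nth(1)[OF len(2)] nth_eq_iff_index_eq by fastforce
qed

lemma eulerian_circuit_map_upt:
  assumes "f 0 = x" and "f m = x" and "\<And>i. i \<le> m \<Longrightarrow> f i \<in> verts G"
    and "(\<Sum>i<m. {#{f i, f (Suc i)}#}) = edges G"
  shows "eulerian_circuit G x (map f [0..<Suc m])"
  unfolding eulerian_circuit_def walk_edges_map_upt mset_map_upt
  using assms by (auto simp: hd_conv_nth last_conv_nth nth_upt simp del: upt_Suc)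

text \<open>Stated for a function \<open>f\<close> so that it serves both for circuits, with
  \<open>f\<close> the list access, and for the paths themselves, with
  \<open>f = pt True P\<close>.\<close>

lemma two_colouring_alternates:
  assumes "X \<inter> Y = {}" and "\<forall>e \<in># edges G. \<exists>x \<in> X. \<exists>y \<in> Y. e = {x, y}"
    and "\<And>i. i < m \<Longrightarrow> adjacent G (f i) (f (Suc i))" and "j \<le> m"
  shows "f j \<in> X \<longleftrightarrow> (f 0 \<in> X \<longleftrightarrow> even j)"
  using assms(4)
proof (induction j)
  case (Suc j)
  then have "{f j, f (Suc j)} \<in># edges G" using assms(3) by (simp add: adjacent_def)
  then have "f (Suc j) \<in> X \<longleftrightarrow> f j \<notin> X"
    using assms(1,2) by (fastforce simp: doubleton_eq_iff)
  then show ?case using Suc by auto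
qed simp

section \<open>Coordinates on the four paths\<close>

text \<open>Indexing the numbers of internal vertices by path names lets the paths be assigned
  freely to the roles \<open>P\<close>, \<open>Q1\<close>, \<open>Q2\<close>, \<open>Q3\<close> of
  the constructions below.\<close>

locale gamma_graph =
  fixes n :: "path_name \<Rightarrow> nat"
begin

definition G :: "gamma_vertex multigraph" where
  "G = Gamma (n PathA) (n PathB) (n PathC) (n PathD)"

abbreviation L :: "path_name \<Rightarrow> nat" where
  "L P \<equiv> Suc (n P)"

text \<open>
  The vertex of the path \<open>P\<close> at distance \<open>k\<close> from \<open>U\<close> if \<open>r\<close> holds, and from \<open>V\<close> otherwise. Keeping
  \<open>r\<close> arbitrary takes care of the symmetry that exchanges \<open>U\<close> and \<open>V\<close>.
\<close>

definition pt :: "bool \<Rightarrow> path_name \<Rightarrow> nat \<Rightarrow> gamma_vertex" where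
  "pt r P k = (if k = 0 then (if r then U else V) else if k = L P then (if r then V else U)
               else Inner P (if r then k - 1 else n P - k))"

definition path_edges :: "bool \<Rightarrow> path_name \<Rightarrow> nat \<Rightarrow> nat \<Rightarrow> gamma_vertex set multiset" where
  "path_edges r P j l = (\<Sum>i<l. {#{pt r P (j + i), pt r P (Suc (j + i))}#})"

lemma pt_0: "pt r P 0 = pt r Q 0" and pt_L: "pt r P (L P) = pt r Q (L Q)"
  by (simp_all add: pt_def)

text \<open>Reduces coincidence of vertices to arithmetic of distances. The first two disjuncts
  arise because all paths share their ends.\<close>

lemma pt_eq_iff:
  assumes "k \<le> L P" and "k' \<le> L Q"
  shows "pt r P k = pt r Q k' \<longleftrightarrow>
    k = 0 \<and> k' = 0 \<or> k = L P \<and> k' = L Q \<or> P = Q \<and> k = k'"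
  using assms by (cases r) (auto simp: pt_def)

lemma pt_flip: "k \<le> L P \<Longrightarrow> pt (\<not> r) P k = pt r P (L P - k)"
  by (auto simp: pt_def)

lemma gamma_path_eq: "gamma_path P (n P) = map (pt True P) [0..<Suc (L P)]"
  by (rule nth_equalityI)
     (auto simp: gamma_path_def pt_def nth_append nth_Cons nth_upt simp del: upt_Suc split: nat.splits)

lemma path_edges_True: "mset (walk_edges (gamma_path P (n P))) = path_edges True P 0 (L P)"
  unfolding gamma_path_eq walk_edges_map_upt mset_map_upt path_edges_def by simp

text \<open>Reading \<open>P\<close> from its other end reverses the order of the summands.\<close>

lemma path_edges_flip: "path_edges (\<not> r) P 0 (L P) = path_edges r P 0 (L P)"
proof -
  have "path_edges (\<not> r) P 0 (L P) = (\<Sum>i<L P. {#{pt r P (L P - Suc i), pt r P (Suc (L P - Suc i))}#})"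
    unfolding path_edges_def
    by (rule sum.cong) (auto simp: pt_flip insert_commute Suc_diff_le)
  also have "\<dots> = path_edges r P 0 (L P)"
    unfolding path_edges_def using sum.nat_diff_reindex[of "\<lambda>i. {#{pt r P i, pt r P (Suc i)}#}" "L P"]
    by simp
  finally show ?thesis .
qed

lemma path_edges_append: "path_edges r P j (k + l) = path_edges r P j k + path_edges r P (j + k) l"
  unfolding path_edges_def sum_lessThan_add by (simp add: add.assoc)

lemma UNIV_path_name: "(UNIV :: path_name set) = {PathA, PathB, PathC, PathD}"
  using path_name.exhaust by auto

lemma edges_G: "edges G = (\<Sum>P\<in>UNIV. path_edges r P 0 (L P))"
proof -
  have "path_edges r P 0 (L P) = path_edges True P 0 (L P)" for P
    using path_edges_flip[of True P] by (cases r) auto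
  then show ?thesis
    by (simp add: G_def Gamma_def path_edges_True UNIV_path_name add.assoc)
qed

lemma edges_G_distinct:
  assumes "distinct [P, Q1, Q2, Q3]"
  shows "edges G = path_edges r P 0 (L P) + path_edges r Q1 0 (L Q1)
    + path_edges r Q2 0 (L Q2) + path_edges r Q3 0 (L Q3)"
proof -
  have "(UNIV :: path_name set) = {P, Q1, Q2, Q3}"
    using assms by (cases P; cases Q1; cases Q2; cases Q3) (auto simp: UNIV_path_name)
  then have "edges G = (\<Sum>R\<in>{P, Q1, Q2, Q3}. path_edges r R 0 (L R))"
    using edges_G[of r] by simp
  then show ?thesis using assms by (simp add: add.assoc)
qed

lemma size_path_edges: "size (path_edges r P j l) = l"
  unfolding path_edges_def by (induction l) simp_all

lemma in_edges_iff:
  "e \<in># edges G \<longleftrightarrow> (\<exists>P i. i < L P \<and> e = {pt r P i, pt r P (Suc i)})"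
proof -
  have "finite (UNIV :: path_name set)" by (simp add: UNIV_path_name)
  then show ?thesis
    unfolding edges_G[of r] path_edges_def by (auto simp: set_mset_sum simp del: sum.lessThan_Suc)
qed

lemma verts_G: "verts G = {pt True P k |P k. k \<le> L P}"
proof -
  have "verts G = (\<Union>P. set (gamma_path P (n P)))"
    by (simp add: G_def Gamma_def UNIV_path_name Un_assoc)
  then show ?thesis unfolding gamma_path_eq by (force simp: less_Suc_eq_le simp del: upt_Suc)
qed

lemma pt_in_verts:
  assumes "k \<le> L P"
  shows "pt r P k \<in> verts G"
proof (cases r)
  case False
  then have "pt r P k = pt True P (L P - k)" using pt_flip[OF assms, of True] by simp
  then show ?thesis unfolding verts_G using diff_le_self by blast
qed (use assms in \<open>auto simp: verts_G\<close>)

lemma adjacent_pt: "i < L P \<Longrightarrow> adjacent G (pt r P i) (pt r P (Suc i))"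
  unfolding adjacent_def in_edges_iff[of _ r] by blast

lemma adjacent_inner:
  assumes "0 < k" and "k < L P" and "adjacent G (pt r P k) y"
  shows "y = pt r P (k - 1) \<or> y = pt r P (Suc k)"
proof -
  obtain Q i where i: "i < L Q" and e: "{pt r P k, y} = {pt r Q i, pt r Q (Suc i)}"
    using assms(3) unfolding adjacent_def in_edges_iff[of _ r] by blast
  from e consider "pt r P k = pt r Q i" "y = pt r Q (Suc i)"
    | "pt r P k = pt r Q (Suc i)" "y = pt r Q i"
    by (auto simp: doubleton_eq_iff)
  then show ?thesis
    using assms(1,2) i pt_eq_iff[of k P i Q r] pt_eq_iff[of k P "Suc i" Q r] by cases auto
qed

section \<open>Runs along a path\<close>

text \<open>Inner vertices have only two neighbours and a circuit cannot turn back, so once it heads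
  for an end of \<open>P\<close> it is forced to go all the way. The induction is strong because
  each step looks at the two preceding vertices.\<close>

lemma eulerian_circuit_follows_path:
  assumes "simple_graph G" and p: "eulerian_circuit G (pt r P s) p" and "s < L P"
    and "p ! 1 = pt r P (s - 1)" and size: "s \<le> size (edges G)" and "i \<le> s"
  shows "p ! i = pt r P (s - i)"
  using \<open>i \<le> s\<close>
proof (induction i rule: less_induct)
  case (less i)
  consider "i = 0" | "i = 1" | j where "i = Suc (Suc j)" by (metis One_nat_def not0_implies_Suc)
  then show ?case
  proof cases
    case 1
    then show ?thesis using eulerian_circuit_nth_0[OF p] by simp
  next
    case 2
    then show ?thesis using assms(4) by simp
  next
    case 3
    have IH: "p ! j = pt r P (s - j)" "p ! Suc j = pt r P (s - Suc j)"
      using less 3 by simp_all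
    have "adjacent G (pt r P (s - Suc j)) (p ! i)"
      using eulerian_circuit_step[OF p, of "Suc j"] IH less.prems size 3 by simp
    then have "p ! i = pt r P (s - Suc j - 1) \<or> p ! i = pt r P (Suc (s - Suc j))"
      using less.prems 3 assms(3) by (intro adjacent_inner) auto
    moreover have "p ! i \<noteq> p ! j"
      using eulerian_circuit_no_backtrack[OF assms(1) p, of j] less.prems size 3 by simp
    ultimately show ?thesis using IH(1) 3 less.prems by (auto simp: Suc_diff_Suc)
  qed
qed

text \<open>Guarantees that the times considered below lie in the range over which
  \<open>avoiding\<close> quantifies.\<close>

lemma size_edges_ge: "L P \<le> size (edges G)"
  by (cases P) (auto simp: edges_G_distinct[of PathA PathB PathC PathD True] size_path_edges)

lemma forward_run:
  assumes "\<And>i. i \<le> l \<Longrightarrow> f (a + i) = pt r P (j + i)"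
  shows "(\<Sum>i<l. {#{f (a + i), f (Suc (a + i))}#}) = path_edges r P j l"
  unfolding path_edges_def
proof (rule sum.cong)
  fix i assume "i \<in> {..<l}"
  then show "{#{f (a + i), f (Suc (a + i))}#} = {#{pt r P (j + i), pt r P (Suc (j + i))}#}"
    using assms[of i] assms[of "Suc i"] by simp
qed simp

lemma backward_run:
  assumes "\<And>i. i \<le> l \<Longrightarrow> f (a + i) = pt r P (j + l - i)"
  shows "(\<Sum>i<l. {#{f (a + i), f (Suc (a + i))}#}) = path_edges r P j l"
proof -
  have "(\<Sum>i<l. {#{f (a + i), f (Suc (a + i))}#})
      = (\<Sum>i<l. {#{pt r P (j + (l - Suc i)), pt r P (Suc (j + (l - Suc i)))}#})"
  proof (rule sum.cong)
    fix i assume "i \<in> {..<l}"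
    then show "{#{f (a + i), f (Suc (a + i))}#}
        = {#{pt r P (j + (l - Suc i)), pt r P (Suc (j + (l - Suc i)))}#}"
      using assms[of i] assms[of "Suc i"] by (simp add: insert_commute Suc_diff_Suc)
  qed simp
  also have "\<dots> = path_edges r P j l"
    unfolding path_edges_def
    by (rule sum.nat_diff_reindex[of "\<lambda>i. {#{pt r P (j + i), pt r P (Suc (j + i))}#}"])
  finally show ?thesis .
qed

section \<open>The bound 2 and the obstruction at a midpoint\<close>

lemma eulerian_circuit_inner_step:
  assumes "eulerian_circuit G (pt r P k) p" and "0 < k" and "k < L P"
  shows "p ! 1 \<in> {pt r P (k - 1), pt r P (Suc k)}"
proof -
  have "adjacent G (pt r P k) (p ! 1)"
    using eulerian_circuit_step[OF assms(1), of 0] eulerian_circuit_nth_0[OF assms(1)]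
      size_edges_ge[of P] assms by simp
  then show ?thesis using adjacent_inner assms(2,3) by blast
qed

text \<open>Avoiding circuits already differ at time 1, where only the two neighbours of an inner
  vertex are available.\<close>

lemma card_mutually_avoiding_le_2:
  assumes "0 < k" and "k < L P" and "\<forall>p \<in> S. eulerian_circuit G (pt r P k) p"
    and "mutually_avoiding G S"
  shows "card S \<le> 2"
proof -
  have "inj_on (\<lambda>p. p ! 1) S"
  proof (rule inj_onI, rule ccontr)
    fix p q assume "p \<in> S" "q \<in> S" "p ! 1 = q ! 1" "p \<noteq> q"
    then have "avoiding G p q" using assms(4) by (simp add: mutually_avoiding_def pairwise_def)
    then show False
      using \<open>p ! 1 = q ! 1\<close> size_edges_ge[of P] assms(1,2) unfolding avoiding_def by force
  qed
  moreover have "(\<lambda>p. p ! 1) ` S \<subseteq> {pt r P (k - 1), pt r P (Suc k)}"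
    using eulerian_circuit_inner_step[OF _ assms(1,2)] assms(3) by blast
  ultimately have "card S \<le> card {pt r P (k - 1), pt r P (Suc k)}"
    by (intro card_inj_on_le) auto
  also have "\<dots> \<le> 2" by (simp add: card_insert_if)
  finally show ?thesis .
qed

lemma not_avoiding_opposite:
  assumes "simple_graph G" and "n PathA = 0" and "0 < s" and s: "L P = 2 * s"
    and p: "eulerian_circuit G (pt r P s) p" and q: "eulerian_circuit G (pt r P s) q"
    and "p ! 1 = pt r P (s - 1)" and "q ! 1 = pt r P (Suc s)"
  shows "\<not> avoiding G p q"
proof -
  have size: "2 * s \<le> size (edges G)" using size_edges_ge[of P] s by simp
  \<comment> \<open>From the midpoint, moving away from one end is moving towards the other at the
    same distance \<open>s\<close>, so the forced-run lemma applies to \<open>q\<close> with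
    \<open>r\<close> negated.\<close>
  have "pt r P s = pt (\<not> r) P s" "pt r P (Suc s) = pt (\<not> r) P (s - 1)"
    using pt_flip[of s P r] pt_flip[of "s - 1" P r] s \<open>0 < s\<close> by (auto simp: mult_2)
  then have "p ! s = pt r P 0" "q ! s = pt (\<not> r) P 0"
    using eulerian_circuit_follows_path[OF assms(1), of r P s p s]
      eulerian_circuit_follows_path[OF assms(1), of "\<not> r" P s q s] assms size by auto
  \<comment> \<open>At time \<open>s\<close> the circuits occupy the two ends, which the single edge
    of \<open>PathA\<close> joins.\<close>
  then have "p ! s = pt r PathA 0" "q ! s = pt r PathA (Suc 0)"
    using assms(2) by (auto simp: pt_def)
  then have "adjacent G (p ! s) (q ! s)" using adjacent_pt[of 0 PathA r] by simp
  moreover have "1 \<le> s" "s \<le> size (edges G) - 1" using size \<open>0 < s\<close> by simp_all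
  ultimately show ?thesis unfolding avoiding_def by blast
qed

lemma avoiding_sym: "avoiding G p q \<Longrightarrow> avoiding G q p"
  by (auto simp: avoiding_def adjacent_def insert_commute)

lemma not_avoiding_midpoint:
  assumes "simple_graph G" and "n PathA = 0" and "0 < s" and s: "L P = 2 * s"
    and p: "eulerian_circuit G (pt r P s) p" and q: "eulerian_circuit G (pt r P s) q"
  shows "\<not> avoiding G p q"
proof
  assume av: "avoiding G p q"
  have "2 * s \<le> size (edges G)" using size_edges_ge[of P] s by simp
  then have "p ! 1 \<noteq> q ! 1" using av \<open>0 < s\<close> unfolding avoiding_def by force
  moreover have "p ! 1 \<in> {pt r P (s - 1), pt r P (Suc s)}" "q ! 1 \<in> {pt r P (s - 1), pt r P (Suc s)}"
    using eulerian_circuit_inner_step[of r P s] p q s \<open>0 < s\<close> by simp_all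
  ultimately consider "p ! 1 = pt r P (s - 1)" "q ! 1 = pt r P (Suc s)"
    | "q ! 1 = pt r P (s - 1)" "p ! 1 = pt r P (Suc s)"
    by auto
  then show False
  proof cases
    case 1
    then show ?thesis using not_avoiding_opposite[OF assms(1-4) p q] av by simp
  next
    case 2
    then show ?thesis
      using not_avoiding_opposite[OF assms(1-4) q p] avoiding_sym[OF av] by simp
  qed
qed

section \<open>Two explicit circuits\<close>

text \<open>
  The circuits described above, as functions of the time; a base at an end of the paths is the case
  \<open>s = 0\<close>.
\<close>

definition circuit_p :: "bool \<Rightarrow> path_name \<Rightarrow> path_name \<Rightarrow> path_name \<Rightarrow> path_name \<Rightarrow> nat \<Rightarrow> nat \<Rightarrow> gamma_vertex"
where
  "circuit_p r P Q1 Q2 Q3 s i =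
    (if i \<le> s then pt r P (s - i)
     else if i \<le> s + L Q1 then pt r Q1 (i - s)
     else if i \<le> s + L Q1 + L Q2 then pt r Q2 (s + L Q1 + L Q2 - i)
     else if i \<le> s + L Q1 + L Q2 + L Q3 then pt r Q3 (i - (s + L Q1 + L Q2))
     else pt r P (s + L Q1 + L Q2 + L Q3 + L P - i))"

definition circuit_q :: "bool \<Rightarrow> path_name \<Rightarrow> path_name \<Rightarrow> path_name \<Rightarrow> path_name \<Rightarrow> nat \<Rightarrow> nat \<Rightarrow> gamma_vertex"
where
  "circuit_q r P Q1 Q2 Q3 t i =
    (if i \<le> t then pt r P (L P - t + i)
     else if i \<le> t + L Q2 then pt r Q2 (t + L Q2 - i)
     else if i \<le> t + L Q2 + L Q3 then pt r Q3 (i - (t + L Q2))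
     else if i \<le> t + L Q2 + L Q3 + L Q1 then pt r Q1 (t + L Q2 + L Q3 + L Q1 - i)
     else pt r P (i - (t + L Q2 + L Q3 + L Q1)))"

text \<open>The edges are collected run by run: the three middle runs cover the paths
  \<open>Q1\<close>, \<open>Q2\<close>, \<open>Q3\<close>, and the first and last runs cover the two
  parts into which the base divides \<open>P\<close>. The first vertex of each later run is given by
  the preceding branch of the definition; \<open>pt_0\<close> and \<open>pt_L\<close> identify the
  two descriptions.\<close>

lemma circuit_p_eulerian:
  assumes "distinct [P, Q1, Q2, Q3]" and st: "s + t = L P" and "0 < t"
    and m: "m = L P + L Q1 + L Q2 + L Q3"
  shows "eulerian_circuit G (pt r P s) (map (circuit_p r P Q1 Q2 Q3 s) [0..<Suc m])"
    (is "eulerian_circuit _ _ (map ?f _)")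
proof (rule eulerian_circuit_map_upt)
  have 1: "(\<Sum>i<s. {#{?f (0 + i), ?f (Suc (0 + i))}#}) = path_edges r P 0 s"
    by (rule backward_run) (simp add: circuit_p_def)
  have 2: "(\<Sum>i<L Q1. {#{?f (s + i), ?f (Suc (s + i))}#}) = path_edges r Q1 0 (L Q1)"
    by (rule forward_run) (auto simp: circuit_p_def pt_0[of r P Q1])
  have 3: "(\<Sum>i<L Q2. {#{?f (s + L Q1 + i), ?f (Suc (s + L Q1 + i))}#}) = path_edges r Q2 0 (L Q2)"
    by (rule backward_run) (auto simp: circuit_p_def pt_L[of r Q1 Q2])
  have 4: "(\<Sum>i<L Q3. {#{?f (s + L Q1 + L Q2 + i), ?f (Suc (s + L Q1 + L Q2 + i))}#})
      = path_edges r Q3 0 (L Q3)"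
    by (rule forward_run) (auto simp: circuit_p_def pt_0[of r Q2 Q3])
  have 5: "(\<Sum>i<t. {#{?f (s + L Q1 + L Q2 + L Q3 + i), ?f (Suc (s + L Q1 + L Q2 + L Q3 + i))}#})
      = path_edges r P s t"
    by (rule backward_run) (use st in \<open>auto simp: circuit_p_def pt_L[of r Q3 P]\<close>)
  have m': "m = s + L Q1 + L Q2 + L Q3 + t" using m st by simp
  have P: "path_edges r P 0 (L P) = path_edges r P 0 s + path_edges r P s t"
    using path_edges_append[of r P 0 s t] st by simp
  show "(\<Sum>i<m. {#{?f i, ?f (Suc i)}#}) = edges G"
    unfolding m' sum_lessThan_add edges_G_distinct[OF assms(1), of r] P
    using 1 unfolding 2 3 4 5 by (simp add: ac_simps)
  show "?f 0 = pt r P s" by (simp add: circuit_p_def)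
  show "?f m = pt r P s" using st \<open>0 < t\<close> m by (simp add: circuit_p_def)
  show "?f i \<in> verts G" if "i \<le> m" for i
    using st unfolding circuit_p_def by (auto intro!: pt_in_verts)
qed

lemma circuit_q_eulerian:
  assumes "distinct [P, Q1, Q2, Q3]" and st: "s + t = L P"
    and m: "m = L P + L Q1 + L Q2 + L Q3"
  shows "eulerian_circuit G (pt r P s) (map (circuit_q r P Q1 Q2 Q3 t) [0..<Suc m])"
    (is "eulerian_circuit _ _ (map ?f _)")
proof (rule eulerian_circuit_map_upt)
  have 1: "(\<Sum>i<t. {#{?f (0 + i), ?f (Suc (0 + i))}#}) = path_edges r P s t"
    by (rule forward_run) (simp add: circuit_q_def flip: st)
  have 2: "(\<Sum>i<L Q2. {#{?f (t + i), ?f (Suc (t + i))}#}) = path_edges r Q2 0 (L Q2)"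
    by (rule backward_run) (use st in \<open>auto simp: circuit_q_def pt_L[of r P Q2]\<close>)
  have 3: "(\<Sum>i<L Q3. {#{?f (t + L Q2 + i), ?f (Suc (t + L Q2 + i))}#}) = path_edges r Q3 0 (L Q3)"
    by (rule forward_run) (auto simp: circuit_q_def pt_0[of r Q2 Q3])
  have 4: "(\<Sum>i<L Q1. {#{?f (t + L Q2 + L Q3 + i), ?f (Suc (t + L Q2 + L Q3 + i))}#})
      = path_edges r Q1 0 (L Q1)"
    by (rule backward_run) (auto simp: circuit_q_def pt_L[of r Q3 Q1])
  have 5: "(\<Sum>i<s. {#{?f (t + L Q2 + L Q3 + L Q1 + i), ?f (Suc (t + L Q2 + L Q3 + L Q1 + i))}#})
      = path_edges r P 0 s"
    by (rule forward_run) (auto simp: circuit_q_def pt_0[of r Q1 P])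
  have m': "m = t + L Q2 + L Q3 + L Q1 + s" using m st by simp
  have P: "path_edges r P 0 (L P) = path_edges r P 0 s + path_edges r P s t"
    using path_edges_append[of r P 0 s t] st by simp
  show "(\<Sum>i<m. {#{?f i, ?f (Suc i)}#}) = edges G"
    unfolding m' sum_lessThan_add edges_G_distinct[OF assms(1), of r] P
    using 1 unfolding 2 3 4 5 by (simp add: ac_simps)
  show "?f 0 = pt r P s" by (simp add: circuit_q_def flip: st)
  \<comment> \<open>If \<open>s = 0\<close>, the last run is empty and time \<open>m\<close> still
    falls in the run along \<open>Q1\<close>, which ends at the base.\<close>
  have "L P - t = s" using st by simp
  then show "?f m = pt r P s"
    using st m pt_0[of r P Q1] by (cases "s = 0") (auto simp: circuit_q_def)
  show "?f i \<in> verts G" if "i \<le> m" for i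
    using st that m unfolding circuit_q_def by (auto intro!: pt_in_verts)
qed

text \<open>The strict bounds assign each junction to the earlier run. Positions are described by
  additions instead of truncated subtractions, so that comparing two circuits becomes linear
  arithmetic.\<close>

lemma circuit_p_cases:
  assumes "s \<le> L P" and "i \<le> L P + L Q1 + L Q2 + L Q3"
  obtains k where "circuit_p r P Q1 Q2 Q3 s i = pt r P k" "k \<le> L P" "k + i = s"
  | k where "circuit_p r P Q1 Q2 Q3 s i = pt r Q1 k" "k \<le> L Q1" "0 < k" "i = s + k"
  | k where "circuit_p r P Q1 Q2 Q3 s i = pt r Q2 k" "k < L Q2" "k + i = s + L Q1 + L Q2"
  | k where "circuit_p r P Q1 Q2 Q3 s i = pt r Q3 k" "k \<le> L Q3" "0 < k" "i = s + L Q1 + L Q2 + k"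
  | k where "circuit_p r P Q1 Q2 Q3 s i = pt r P k" "k < L P" "k + i = s + L Q1 + L Q2 + L Q3 + L P"
proof -
  note [simp] = circuit_p_def
  consider "i \<le> s" | "s < i" "i \<le> s + L Q1" | "s + L Q1 < i" "i \<le> s + L Q1 + L Q2"
    | "s + L Q1 + L Q2 < i" "i \<le> s + L Q1 + L Q2 + L Q3" | "s + L Q1 + L Q2 + L Q3 < i"
    by linarith
  then show thesis
  proof cases
    case 1 then show ?thesis using that(1)[of "s - i"] assms by simp
  next
    case 2 then show ?thesis using that(2)[of "i - s"] assms by simp
  next
    case 3 then show ?thesis using that(3)[of "s + L Q1 + L Q2 - i"] assms by simp
  next
    case 4 then show ?thesis using that(4)[of "i - (s + L Q1 + L Q2)"] assms by simp
  next
    case 5 then show ?thesis using that(5)[of "s + L Q1 + L Q2 + L Q3 + L P - i"] assms by simp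
  qed
qed

lemma circuit_q_cases:
  assumes "t \<le> L P" and "i \<le> L P + L Q1 + L Q2 + L Q3"
  obtains k where "circuit_q r P Q1 Q2 Q3 t i = pt r P k" "k \<le> L P" "k + t = L P + i"
  | k where "circuit_q r P Q1 Q2 Q3 t i = pt r Q2 k" "k < L Q2" "k + i = t + L Q2"
  | k where "circuit_q r P Q1 Q2 Q3 t i = pt r Q3 k" "k \<le> L Q3" "0 < k" "i = t + L Q2 + k"
  | k where "circuit_q r P Q1 Q2 Q3 t i = pt r Q1 k" "k < L Q1" "k + i = t + L Q2 + L Q3 + L Q1"
  | k where "circuit_q r P Q1 Q2 Q3 t i = pt r P k" "k \<le> L P" "0 < k" "i = t + L Q2 + L Q3 + L Q1 + k"
proof -
  note [simp] = circuit_q_def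
  consider "i \<le> t" | "t < i" "i \<le> t + L Q2" | "t + L Q2 < i" "i \<le> t + L Q2 + L Q3"
    | "t + L Q2 + L Q3 < i" "i \<le> t + L Q2 + L Q3 + L Q1" | "t + L Q2 + L Q3 + L Q1 < i"
    by linarith
  then show thesis
  proof cases
    case 1 then show ?thesis using that(1)[of "L P - t + i"] assms by simp
  next
    case 2 then show ?thesis using that(2)[of "t + L Q2 - i"] assms by simp
  next
    case 3 then show ?thesis using that(3)[of "i - (t + L Q2)"] assms by simp
  next
    case 4 then show ?thesis using that(4)[of "t + L Q2 + L Q3 + L Q1 - i"] assms by simp
  next
    case 5 then show ?thesis using that(5)[of "i - (t + L Q2 + L Q3 + L Q1)"] assms by simp
  qed
qed

text \<open>The condition \<open>t \<noteq> s + L Q1\<close> keeps the circuits apart on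
  \<open>Q2\<close> and \<open>Q3\<close>, which both traverse in the same direction with time lag
  \<open>t - (s + L Q1)\<close>. By \<open>s + L Q1 < t + L Q2 + L Q3\<close> the first circuit
  leaves \<open>Q1\<close> before the second enters it. By \<open>t < s + L Q1 + L Q2 + L Q3\<close>
  the second has finished its first run on \<open>P\<close> before the first returns there. Their
  last runs on \<open>P\<close> go in opposite directions and meet only at the final time.\<close>

lemma circuits_meet_only_at_ends:
  assumes "distinct [P, Q1, Q2, Q3]" and "s + t = L P" and "s < t" and "t \<noteq> s + L Q1"
    and "s + L Q1 < t + L Q2 + L Q3" and "t < s + L Q1 + L Q2 + L Q3"
    and "0 < i" and "i < L P + L Q1 + L Q2 + L Q3"
  shows "circuit_p r P Q1 Q2 Q3 s i \<noteq> circuit_q r P Q1 Q2 Q3 t i"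
proof -
  define lp l1 l2 l3 where l: "lp = L P" "l1 = L Q1" "l2 = L Q2" "l3 = L Q3"
  have pos: "0 < lp" "0 < l1" "0 < l2" "0 < l3" by (simp_all add: l)
  note arith = assms(2-8)[folded l] pos
  have distinct: "P \<noteq> Q1" "P \<noteq> Q2" "P \<noteq> Q3" "Q1 \<noteq> Q2" "Q1 \<noteq> Q3" "Q2 \<noteq> Q3"
    "Q1 \<noteq> P" "Q2 \<noteq> P" "Q3 \<noteq> P" "Q2 \<noteq> Q1" "Q3 \<noteq> Q1" "Q3 \<noteq> Q2"
    using assms(1) by auto
  have bounds: "s \<le> L P" "t \<le> L P" "i \<le> L P + L Q1 + L Q2 + L Q3" using assms by simp_all
  show ?thesis
    \<comment> \<open>Each of the 25 pairs of runs yields a linear problem through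
      \<open>pt_eq_iff\<close>.\<close>
    by (rule circuit_p_cases[OF bounds(1,3), of r]; rule circuit_q_cases[OF bounds(2,3), of r];
        simp only:; subst pt_eq_iff; (simp only: distinct refl simp_thms)?; fold l; insert arith; linarith)
qed

lemma avoiding_pair_exists:
  assumes "bipartite G" and d: "distinct [P, Q1, Q2, Q3]" and st: "s + t = L P" and "s < t"
    and "t \<noteq> s + L Q1" and "s + L Q1 < t + L Q2 + L Q3" and "t < s + L Q1 + L Q2 + L Q3"
  shows "\<exists>p q. eulerian_circuit G (pt r P s) p \<and> eulerian_circuit G (pt r P s) q \<and> avoiding G p q"
proof -
  define m where "m = L P + L Q1 + L Q2 + L Q3"
  have size: "size (edges G) = m"
    using edges_G_distinct[OF d, of r] by (simp add: size_path_edges m_def)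
  let ?p = "map (circuit_p r P Q1 Q2 Q3 s) [0..<Suc m]"
  let ?q = "map (circuit_q r P Q1 Q2 Q3 t) [0..<Suc m]"
  have p: "eulerian_circuit G (pt r P s) ?p"
    using circuit_p_eulerian[OF d st _ m_def] \<open>s < t\<close> by simp
  have q: "eulerian_circuit G (pt r P s) ?q"
    using circuit_q_eulerian[OF d st m_def] .
  obtain X Y where XY: "X \<inter> Y = {}" "\<forall>e \<in># edges G. \<exists>x \<in> X. \<exists>y \<in> Y. e = {x, y}"
    using assms(1) unfolding bipartite_def by blast
  have same_colour: "?p ! i \<in> X \<longleftrightarrow> ?q ! i \<in> X" if "i \<le> m" for i
    using two_colouring_alternates[where f = "(!) ?p", OF XY eulerian_circuit_step[OF p], of m i]
      two_colouring_alternates[where f = "(!) ?q", OF XY eulerian_circuit_step[OF q], of m i]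
      eulerian_circuit_nth_0[OF p] eulerian_circuit_nth_0[OF q] that size by simp
  have "avoiding G ?p ?q"
    unfolding avoiding_def size
  proof (intro allI impI conjI)
    fix i assume i: "1 \<le> i \<and> i \<le> m - 1"
    then show "?p ! i \<noteq> ?q ! i"
      using circuits_meet_only_at_ends[OF d st assms(4-7), of i r] m_def
      by (simp del: upt_Suc)
    show "\<not> adjacent G (?p ! i) (?q ! i)"
    proof
      assume "adjacent G (?p ! i) (?q ! i)"
      then have "?p ! i \<in> X \<longleftrightarrow> ?q ! i \<notin> X"
        using XY unfolding adjacent_def by (fastforce simp: doubleton_eq_iff)
      moreover have "i \<le> m" using i by arith
      ultimately show False using same_colour by blast
    qed
  qed
  then show ?thesis using p q by blast
qed

section \<open>Index, bipartiteness and the choice of circuits\<close>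

lemma avoidance_index_eq_2_iff:
  assumes "0 < n P"
  shows "avoidance_index G = 2 \<longleftrightarrow> (\<forall>x \<in> verts G. \<exists>p q.
     eulerian_circuit G x p \<and> eulerian_circuit G x q \<and> avoiding G p q)"
proof -
  define A where "A k \<longleftrightarrow> (\<forall>x \<in> verts G. \<exists>S. finite S \<and> card S = k \<and>
    (\<forall>p \<in> S. eulerian_circuit G x p) \<and> mutually_avoiding G S)" for k
  have index: "avoidance_index G = Greatest A" by (simp add: avoidance_index_def A_def[abs_def])
  have "pt True P 1 \<in> verts G" by (rule pt_in_verts) simp
  then have le_2: "k \<le> 2" if "A k" for k
    using that card_mutually_avoiding_le_2[of 1 P _ True] \<open>0 < n P\<close> unfolding A_def by fastforce
  \<comment> \<open>\<open>Greatest A\<close> satisfies \<open>A\<close> only if some bounded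
    \<open>k\<close> does; the empty set of circuits provides \<open>k = 0\<close>.\<close>
  have "A 0" unfolding A_def
    by (intro ballI exI[of _ "{}"]) (simp add: mutually_avoiding_def)
  then have "A (Greatest A)" using le_2 GreatestI_nat by blast
  then have "avoidance_index G = 2 \<longleftrightarrow> A 2"
    unfolding index using Greatest_equality[of A 2] le_2 by metis
  also have "\<dots> \<longleftrightarrow> (\<forall>x \<in> verts G. \<exists>p q.
     eulerian_circuit G x p \<and> eulerian_circuit G x q \<and> avoiding G p q)"
    unfolding A_def
  proof (intro ball_cong refl iffI)
    fix x assume "\<exists>S. finite S \<and> card S = 2 \<and> (\<forall>p \<in> S. eulerian_circuit G x p) \<and> mutually_avoiding G S"
    then show "\<exists>p q. eulerian_circuit G x p \<and> eulerian_circuit G x q \<and> avoiding G p q"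
      unfolding card_2_iff mutually_avoiding_def pairwise_def by blast
  next
    fix x assume "\<exists>p q. eulerian_circuit G x p \<and> eulerian_circuit G x q \<and> avoiding G p q"
    then obtain p q where pq: "eulerian_circuit G x p" "eulerian_circuit G x q" "avoiding G p q"
      by blast
    \<comment> \<open>Time 1 is thus in the range of \<open>avoiding\<close>, which would otherwise
      be vacuous and allow \<open>p = q\<close>.\<close>
    have "1 \<le> size (edges G) - 1" using size_edges_ge[of P] \<open>0 < n P\<close> by simp
    then have "p \<noteq> q" using pq(3) unfolding avoiding_def by blast
    then have "card {p, q} = 2" by simp
    moreover have "mutually_avoiding G {p, q}"
      using pq(3) avoiding_sym unfolding mutually_avoiding_def pairwise_def by blast
    ultimately show "\<exists>S. finite S \<and> card S = 2 \<and> (\<forall>p \<in> S. eulerian_circuit G x p) \<and> mutually_avoiding G S"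
      using pq by (intro exI[of _ "{p, q}"]) simp
  qed
  finally show ?thesis .
qed

text \<open>The edge of \<open>PathA\<close> separates the colours of \<open>U\<close> and
  \<open>V\<close>, while along any path \<open>P\<close> colours alternate for \<open>L P\<close>
  steps; so every \<open>L P\<close> is odd.\<close>

lemma bipartite_iff_even:
  assumes "n PathA = 0"
  shows "bipartite G \<longleftrightarrow> (\<forall>P. even (n P))"
proof
  assume "bipartite G"
  then obtain X Y where XY: "X \<inter> Y = {}" "\<forall>e \<in># edges G. \<exists>x \<in> X. \<exists>y \<in> Y. e = {x, y}"
    unfolding bipartite_def by blast
  have V: "V \<in> X \<longleftrightarrow> (U \<in> X \<longleftrightarrow> odd (n P))" for P
    using two_colouring_alternates[where f = "pt True P", OF XY adjacent_pt, of "L P" "L P"]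
    by (simp add: pt_def)
  then show "\<forall>P. even (n P)" using V[of PathA] assms by auto
next
  assume ev: "\<forall>P. even (n P)"
  \<comment> \<open>Colour by parity of the distance from \<open>U\<close> along a path; since every
    \<open>L P\<close> is odd, all paths agree on the colour of \<open>V\<close>.\<close>
  define X where "X = (\<lambda>(P, k). pt True P k) ` {(P, k). k \<le> L P \<and> even k}"
  have X: "pt True P k \<in> X \<longleftrightarrow> even k" if "k \<le> L P" for P k
  proof
    assume "pt True P k \<in> X"
    then obtain Q j where "pt True P k = pt True Q j" "j \<le> L Q" "even j" unfolding X_def by auto
    then show "even k" using ev pt_eq_iff[OF that, of j Q True] by auto
  qed (use that in \<open>force simp: X_def\<close>)
  have "\<exists>x \<in> X. \<exists>y \<in> verts G - X. e = {x, y}" if edge: "e \<in># edges G" for e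
  proof -
    obtain P i where i: "i < L P" "e = {pt True P i, pt True P (Suc i)}"
      using edge in_edges_iff[of e True] by blast
    have "pt True P i \<in> verts G" "pt True P (Suc i) \<in> verts G"
      using i(1) by (simp_all add: pt_in_verts)
    moreover have "pt True P i \<in> X \<longleftrightarrow> even i" "pt True P (Suc i) \<in> X \<longleftrightarrow> odd i"
      using X[of i P] X[of "Suc i" P] i(1) by simp_all
    ultimately show ?thesis unfolding i(2) by (cases "even i") (auto simp: doubleton_eq_iff)
  qed
  moreover have "X \<subseteq> verts G" unfolding X_def by (auto simp: pt_in_verts)
  ultimately show "bipartite G"
    unfolding bipartite_def by (intro exI[of _ X] exI[of _ "verts G - X"]) auto
qed

text \<open>The default choice is \<open>Q1 = PathA\<close>, of length 1, which fails only if
  \<open>t = Suc s\<close>. In that case \<open>Q1\<close> is one of the longer paths, no longer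
  than the path chosen as \<open>Q3\<close>, and \<open>PathA\<close> becomes
  \<open>Q2\<close>.\<close>

lemma avoiding_pair_exists_at:
  assumes A: "n PathA = 0" and B: "0 < n PathB" and "n PathB \<le> n PathC" and "n PathC \<le> n PathD"
    and D: "n PathD < n PathB + n PathC + 3" and bip: "bipartite G" and x: "x \<in> verts G"
  shows "\<exists>p q. eulerian_circuit G x p \<and> eulerian_circuit G x q \<and> avoiding G p q"
proof -
  have ev: "even (n P)" for P using bip bipartite_iff_even[OF A] by blast
  obtain P' k where k: "x = pt True P' k" "k \<le> L P'" using x unfolding verts_G by blast
  \<comment> \<open>Odd lengths rule out a midpoint, so \<open>r\<close> can be chosen to measure
    from the nearer end. The vertices \<open>U\<close> and \<open>V\<close> lie on every path and
    are placed on \<open>PathB\<close>.\<close>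
  obtain r P s where P: "x = pt r P s" "2 * s < L P" "P \<noteq> PathA" "s = 0 \<longrightarrow> P = PathB"
  proof (cases "k = 0 \<or> k = L P'")
    case True
    then have "x = pt (k = 0) PathB 0" using k by (auto simp: pt_def)
    then show ?thesis using that[of "k = 0" PathB 0] by simp
  next
    case False
    then have "P' \<noteq> PathA" using A k(2) by auto
    have "2 * k \<noteq> L P'" using ev[of P'] by (metis even_Suc dvd_triv_left)
    then consider "2 * k < L P'" | "2 * (L P' - k) < L P'" using k(2) by linarith
    then show ?thesis
    proof cases
      case 1
      then show ?thesis using that[of True P' k] k(1) False \<open>P' \<noteq> PathA\<close> by simp
    next
      case 2
      moreover have "x = pt False P' (L P' - k)" using k pt_flip[of "L P' - k" P' True] by simp
      ultimately show ?thesis using that[of False P' "L P' - k"] False k(2) \<open>P' \<noteq> PathA\<close> by simp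
    qed
  qed
  have two: "2 \<le> n PathB" using ev[of PathB] B by (auto elim!: evenE)
  define t where "t = L P - s"
  have t: "s + t = L P" "s < t" using P(2) unfolding t_def by simp_all
  note pair = avoiding_pair_exists[OF bip _ t(1,2), of _ _ _ r, folded P(1)]
  show ?thesis
  proof (cases "t = Suc s")
    case True
    show ?thesis
    proof (cases P)
      case PathB
      then show ?thesis using pair[of PathC PathA PathD] True assms two by simp
    next
      case PathC
      then show ?thesis using pair[of PathB PathA PathD] True assms two by simp
    next
      case PathD
      then show ?thesis using pair[of PathB PathA PathC] True assms two by simp
    qed (use P in simp)
  next
    case False
    show ?thesis
    proof (cases P)
      case PathB
      then show ?thesis using pair[of PathA PathC PathD] False assms t by simp
    next
      case PathC
      then show ?thesis using pair[of PathA PathB PathD] False assms t by simp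
    next
      case PathD
      \<comment> \<open>Here the bound on \<open>n PathD\<close> enters: as \<open>0 < s\<close>, we
        have \<open>t \<le> n PathD < n PathB + n PathC + 3\<close>, and the right side is the total
        length of the other three paths.\<close>
      then have "0 < s" using P(4) by auto
      then show ?thesis using PathD pair[of PathA PathB PathC] False assms t by simp
    qed (use P in simp)
  qed
qed

lemma no_avoiding_pair_at:
  assumes "simple_graph G" and A: "n PathA = 0" and "\<not> bipartite G"
  shows "\<exists>x \<in> verts G. \<forall>p q. eulerian_circuit G x p \<longrightarrow> eulerian_circuit G x q \<longrightarrow> \<not> avoiding G p q"
proof -
  obtain P where "odd (n P)" using assms(3) bipartite_iff_even[OF A] by blast
  then obtain s where s: "L P = 2 * s" by (metis even_Suc evenE)
  then have "0 < s" "s \<le> L P" by auto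
  then show ?thesis
    using not_avoiding_midpoint[OF assms(1) A \<open>0 < s\<close> s] pt_in_verts by blast
qed

text \<open>Two paths without internal vertices would double the edge between \<open>U\<close> and
  \<open>V\<close>.\<close>

lemma simple_imp_B_pos:
  assumes "simple_graph G" and "n PathA = 0"
  shows "0 < n PathB"
proof (rule ccontr)
  assume "\<not> 0 < n PathB"
  then have "n PathB = 0" by simp
  then have "path_edges True PathA 0 (L PathA) = {#{U, V}#}" "path_edges True PathB 0 (L PathB) = {#{U, V}#}"
    using assms(2) by (simp_all add: path_edges_def pt_def)
  then have "count (edges G) {U, V} \<ge> 2"
    using edges_G_distinct[of PathA PathB PathC PathD True] by simp
  moreover from this have "{U, V} \<in># edges G" by (intro count_inI) simp
  ultimately show False using assms(1) unfolding simple_graph_def by fastforce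
qed

end

theorem theorem7:
  fixes b c d :: nat
  assumes "b \<le> c" and "c \<le> d"
    and "simple_graph (Gamma 0 b c d)"
    and "d < b + c + 3"
  shows "avoidance_index (Gamma 0 b c d) = 2 \<longleftrightarrow> bipartite (Gamma 0 b c d)"
proof -
  interpret gamma_graph "case_path_name 0 b c d" .
  have G: "Gamma 0 b c d = G" by (simp add: G_def)
  have simple: "simple_graph G" using assms(3) G by simp
  have b: "0 < b" using simple_imp_B_pos[OF simple] by simp
  have index: "avoidance_index G = 2 \<longleftrightarrow> (\<forall>x \<in> verts G. \<exists>p q.
      eulerian_circuit G x p \<and> eulerian_circuit G x q \<and> avoiding G p q)"
    using b by (intro avoidance_index_eq_2_iff[of PathB]) simp
  show ?thesis
    unfolding G
  proof
    assume "bipartite G"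
    then show "avoidance_index G = 2"
      unfolding index using avoiding_pair_exists_at b assms(1,2,4) by simp
  next
    assume "avoidance_index G = 2"
    then show "bipartite G"
      unfolding index using no_avoiding_pair_at[OF simple] by (metis path_name.case(1))
  qed
qed

end
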